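(* Let $\mathcal{A}$ be an independence algebra with universe $A$ and let $\mathcal{B}$ be a non-empty subalgebra of $\mathcal{A}$ with universe $B$. Assume $\mathcal{B}\neq\mathcal{A}$ and that either $\dim B\geq 2$, or $\langle\emptyset\rangle\neq\emptyset$ and $\dim B=1$. Let $T(\mathcal{A},\mathcal{B})$ be the semigroup of all endomorphisms of $\mathcal{A}$ whose image is contained in $B$. If $\alpha,\beta\in T(\mathcal{A},\mathcal{B})$, then $\alpha=\lambda\beta\mu$ for some $\lambda\in T(\mathcal{A},\mathcal{B})$ and $\mu\in T(\mathcal{A},\mathcal{B})^1$ if and only if $\rho(\alpha)\leq\dim(B\beta)$. Consequently, $\alpha\,\mathcal{J}\,\beta$ in $T(\mathcal{A},\mathcal{B})$ if and only if one of the following happens: - $\ker\alpha=\ker\beta$, or - $\rho(\alpha)=\dim(B\alpha)=\dim(B\beta)=\rho(\beta)$.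
   Context: An algebra $\mathcal{A}=\langle A;F\rangle$ has a non-empty universe $A$ and a set $F$ of finitary operations. For $X\subseteq A$, $\langle X\rangle$ is the set of all $t(a_1,\dots,a_n)$ with $t$ a term operation and $a_i\in X$ (the subalgebra generated by $X$); $\langle\emptyset\rangle$ is the set of constants, i.e. values of nullary term operations (possibly empty). $X$ is independent if $x\notin\langle X\setminus\{x\}\rangle$ for all $x\in X$; a basis of a subalgebra is an independent generating set. Exchange property (EP): for all $X\subseteq A$ and $a,b\in A$, if $b\in\langle X\cup\{a\}\rangle$ and $b\notin\langle X\rangle$ then $a\in\langle X\cup\{b\}\rangle$. Under (EP) every subalgebra has a basis, all its bases have the same cardinality (its dimension, $\dim$), and independent sets extend to bases. Free basis property (F): every map from a basis of $\mathcal{A}$ to $A$ extends to an endomorphism of $\mathcal{A}$. An independence algebra is an algebra satisfying (EP) and (F). Dimensions may be finite or infinite. Maps are written on the right and composed left to right. $\rho(\alpha)=\dim(A\alpha)$; $\ker\alpha=\{(x,y)\in A\times A: x\alpha=y\alpha\}$. $T(\mathcal{A},\mathcal{B})^1$ is the monoid obtained by adjoining an identity to $T(\mathcal{A},\mathcal{B})$. $\mathcal{J}$ is Green's relation: $a\,\mathcal{J}\,b$ in a semigroup $S$ iff $S^1aS^1=S^1bS^1$. *)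

theory Defs
  imports "HOL-Algebra.Group"
begin

unbundle cardinal_syntax

text \<open>
  An algebra is given by its universe \<open>A\<close> and a set \<open>F\<close> of finitary operations; an operation of
  arity \<open>n\<close> is a pair \<open>(n, f)\<close>, where only the values of \<open>f\<close> on lists of length \<open>n\<close> over \<open>A\<close>
  matter. Arity 0 is allowed.
\<close>

type_synonym 'a ops = "(nat \<times> ('a list \<Rightarrow> 'a)) set"

definition closed_under :: "'a ops \<Rightarrow> 'a set \<Rightarrow> bool" where
  "closed_under F S \<longleftrightarrow>
     (\<forall>(n, f) \<in> F. \<forall>xs. length xs = n \<and> set xs \<subseteq> S \<longrightarrow> f xs \<in> S)"

definition is_algebra :: "'a set \<Rightarrow> 'a ops \<Rightarrow> bool" where
  "is_algebra A F \<longleftrightarrow> A \<noteq> {} \<and> closed_under F A"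

definition is_subalgebra :: "'a set \<Rightarrow> 'a ops \<Rightarrow> 'a set \<Rightarrow> bool" where
  "is_subalgebra A F B \<longleftrightarrow> B \<subseteq> A \<and> closed_under F B"

text \<open>
  \<open>term_op F n t\<close>: \<open>t\<close> is an \<open>n\<close>-ary term operation. There are no projections of arity 0, so the
  nullary term operations are exactly those built from the nullary operations in \<open>F\<close>.
\<close>

inductive term_op :: "'a ops \<Rightarrow> nat \<Rightarrow> ('a list \<Rightarrow> 'a) \<Rightarrow> bool" for F n where
  proj: "i < n \<Longrightarrow> term_op F n (\<lambda>xs. xs ! i)"
| comp: "(m, f) \<in> F \<Longrightarrow> length ts = m \<Longrightarrow> (\<forall>t \<in> set ts. term_op F n t) \<Longrightarrow>
           term_op F n (\<lambda>xs. f (map (\<lambda>t. t xs) ts))"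

definition gen :: "'a ops \<Rightarrow> 'a set \<Rightarrow> 'a set" where
  "gen F X = {t xs | n t xs. term_op F n t \<and> length xs = n \<and> set xs \<subseteq> X}"

definition indep :: "'a set \<Rightarrow> 'a ops \<Rightarrow> 'a set \<Rightarrow> bool" where
  "indep A F X \<longleftrightarrow> X \<subseteq> A \<and> (\<forall>x \<in> X. x \<notin> gen F (X - {x}))"

definition alg_basis :: "'a set \<Rightarrow> 'a ops \<Rightarrow> 'a set \<Rightarrow> 'a set \<Rightarrow> bool" where
  "alg_basis A F S X \<longleftrightarrow> indep A F X \<and> gen F X = S"

text \<open>
  The dimension of a subalgebra \<open>S\<close> is a cardinal, possibly infinite, in the sense of
  \<^theory>\<open>HOL.BNF_Cardinal_Order_Relation\<close>. Under the exchange property it does not depend on the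
  chosen basis up to \<open>=o\<close>, so dimensions are to be compared by \<open>=o\<close> and \<open>\<le>o\<close> only.
\<close>

definition alg_dim :: "'a set \<Rightarrow> 'a ops \<Rightarrow> 'a set \<Rightarrow> 'a rel" where
  "alg_dim A F S = card_of (SOME X. alg_basis A F S X)"

definition exchange_property :: "'a set \<Rightarrow> 'a ops \<Rightarrow> bool" where
  "exchange_property A F \<longleftrightarrow>
     (\<forall>X a b. X \<subseteq> A \<longrightarrow> a \<in> A \<longrightarrow> b \<in> A \<longrightarrow>
        b \<in> gen F (insert a X) \<longrightarrow> b \<notin> gen F X \<longrightarrow> a \<in> gen F (insert b X))"

text \<open>
  Maps with domain \<open>A\<close> are undefined outside \<open>A\<close>, so that equality of maps is equality on \<open>A\<close>.
\<close>

definition endos :: "'a set \<Rightarrow> 'a ops \<Rightarrow> ('a \<Rightarrow> 'a) set" where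
  "endos A F = {\<alpha> \<in> A \<rightarrow>\<^sub>E A.
     \<forall>(n, f) \<in> F. \<forall>xs. length xs = n \<and> set xs \<subseteq> A \<longrightarrow> \<alpha> (f xs) = f (map \<alpha> xs)}"

definition free_basis_property :: "'a set \<Rightarrow> 'a ops \<Rightarrow> bool" where
  "free_basis_property A F \<longleftrightarrow>
     (\<forall>X g. alg_basis A F A X \<longrightarrow> g \<in> X \<rightarrow> A \<longrightarrow> (\<exists>\<alpha> \<in> endos A F. \<forall>x \<in> X. \<alpha> x = g x))"

definition independence_algebra :: "'a set \<Rightarrow> 'a ops \<Rightarrow> bool" where
  "independence_algebra A F \<longleftrightarrow>
     is_algebra A F \<and> exchange_property A F \<and> free_basis_property A F"

definition endos_into :: "'a set \<Rightarrow> 'a ops \<Rightarrow> 'a set \<Rightarrow> ('a \<Rightarrow> 'a) set" where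
  "endos_into A F B = {\<alpha> \<in> endos A F. \<alpha> ` A \<subseteq> B}"

text \<open>Maps act on the right: in \<open>then_map A \<alpha> \<beta>\<close> the map \<open>\<alpha>\<close> is applied first.\<close>

definition then_map :: "'a set \<Rightarrow> ('a \<Rightarrow> 'a) \<Rightarrow> ('a \<Rightarrow> 'a) \<Rightarrow> 'a \<Rightarrow> 'a" where
  "then_map A \<alpha> \<beta> = compose A \<beta> \<alpha>"

definition map_rank :: "'a set \<Rightarrow> 'a ops \<Rightarrow> ('a \<Rightarrow> 'a) \<Rightarrow> 'a rel" where
  "map_rank A F \<alpha> = alg_dim A F (\<alpha> ` A)"

definition map_ker :: "'a set \<Rightarrow> ('a \<Rightarrow> 'a) \<Rightarrow> 'a rel" where
  "map_ker A \<alpha> = {(x, y) \<in> A \<times> A. \<alpha> x = \<alpha> y}"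

text \<open>
  The monoid \<open>S\<^sup>1\<close> for a semigroup with carrier \<open>S\<close> and multiplication \<open>mul\<close>: the elements of \<open>S\<close>
  are tagged by \<open>Some\<close>, and \<open>None\<close> is the new identity (adjoined even if \<open>S\<close> already has one, which
  does not affect the relation \<open>\<J>\<close>).
\<close>

definition adjoin_one :: "'b set \<Rightarrow> ('b \<Rightarrow> 'b \<Rightarrow> 'b) \<Rightarrow> 'b option monoid" where
  "adjoin_one S mul =
     \<lparr>carrier = insert None (Some ` S),
      mult = (\<lambda>x y. case x of None \<Rightarrow> y | Some a \<Rightarrow>
                (case y of None \<Rightarrow> Some a | Some b \<Rightarrow> Some (mul a b))),
      one = None\<rparr>"

definition principal_ideal :: "'b set \<Rightarrow> ('b \<Rightarrow> 'b \<Rightarrow> 'b) \<Rightarrow> 'b \<Rightarrow> 'b option set" where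
  "principal_ideal S mul a =
     (let M = adjoin_one S mul in
        {x \<otimes>\<^bsub>M\<^esub> Some a \<otimes>\<^bsub>M\<^esub> y | x y. x \<in> carrier M \<and> y \<in> carrier M})"

definition green_J :: "'b set \<Rightarrow> ('b \<Rightarrow> 'b \<Rightarrow> 'b) \<Rightarrow> 'b \<Rightarrow> 'b \<Rightarrow> bool" where
  "green_J S mul a b \<longleftrightarrow> principal_ideal S mul a = principal_ideal S mul b"

end

theory Submission
  imports Defs
begin

text \<open>
  The subalgebra generated by a set defines a finitary closure operator with the exchange property,
  so independent sets extend to bases and never exceed a generating set in cardinality; hence
  dimension is monotone and does not increase under endomorphisms. If \<open>\<alpha> = \<gamma>\<beta>\<mu>\<close> then
  \<open>A\<alpha> \<subseteq> B\<beta>\<mu>\<close>. Conversely, embed a basis \<open>Y\<close> of \<open>A\<alpha>\<close> into a basis of \<open>B\<beta>\<close>, let \<open>\<delta>\<close> send \<open>y \<in> Y\<close>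
  to a \<open>\<beta>\<close>-preimage in \<open>B\<close> of its copy and let \<open>\<mu>\<close> send this copy back to \<open>y\<close>; then
  \<open>\<alpha> = (\<alpha>\<delta>)\<beta>\<mu>\<close>.

  If \<open>\<alpha> = \<lambda>\<beta>\<mu>\<close> and \<open>\<beta> = \<lambda>'\<alpha>\<mu>'\<close> with \<open>\<lambda> = \<lambda>' = 1\<close>, the kernels agree. If one of the left factors
  lies in the semigroup, going around the cycle writes each of \<open>\<alpha>\<close>, \<open>\<beta>\<close> as a product with middle
  factor \<open>\<alpha>\<close> and as one with middle factor \<open>\<beta>\<close>, in each case with a left factor in the semigroup,
  so the first part yields the equality of all four dimensions.
\<close>

section \<open>Generated subalgebras\<close>

lemma subset_gen: "X \<subseteq> gen F X"
proof
  fix x assume "x \<in> X"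
  have "term_op F 1 (\<lambda>xs. xs ! 0)" by (rule term_op.proj) simp
  then show "x \<in> gen F X"
    unfolding gen_def using \<open>x \<in> X\<close>
    by (intro CollectI exI[of _ 1] exI[of _ "\<lambda>xs. xs ! 0"] exI[of _ "[x]"]) auto
qed

lemma term_op_in_gen: "term_op F (length xs) t \<Longrightarrow> set xs \<subseteq> X \<Longrightarrow> t xs \<in> gen F X"
  unfolding gen_def by blast

lemma genE:
  assumes "y \<in> gen F X"
  obtains t xs where "term_op F (length xs) t" "set xs \<subseteq> X" "y = t xs"
  using assms unfolding gen_def by blast

lemma gen_mono: "X \<subseteq> Y \<Longrightarrow> gen F X \<subseteq> gen F Y"
  unfolding gen_def by blast

lemma gen_monoD: "x \<in> gen F X \<Longrightarrow> X \<subseteq> Y \<Longrightarrow> x \<in> gen F Y"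
  using gen_mono by (rule subsetD)

lemma gen_finite_subset:
  assumes "x \<in> gen F X"
  obtains Y where "finite Y" "Y \<subseteq> X" "x \<in> gen F Y"
  using assms unfolding gen_def by blast

lemma term_op_closed:
  assumes "term_op F n t" "closed_under F S" "length xs = n" "set xs \<subseteq> S"
  shows "t xs \<in> S"
  using assms(1)
proof induction
  case (proj i)
  then show ?case using assms(3,4) by auto
next
  case (comp m f ts)
  then have "set (map (\<lambda>t. t xs) ts) \<subseteq> S" by auto
  then show ?case
    using comp(1,2) assms(2) unfolding closed_under_def by fastforce
qed

lemma gen_least: "X \<subseteq> S \<Longrightarrow> closed_under F S \<Longrightarrow> gen F X \<subseteq> S"
  unfolding gen_def using term_op_closed by blast

text \<open>The list \<open>is\<close> says where in a longer argument list the old arguments sit.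
  Only projections have to change, so term operations of different arities can be moved to one
  common arity \<open>N\<close>.\<close>

lemma term_op_reindex:
  assumes "term_op F n t" and "length is = n" and "set is \<subseteq> {..<N}"
  shows "\<exists>t'. term_op F N t' \<and> (\<forall>xs. t' xs = t (map ((!) xs) is))"
  using assms(1)
proof induction
  case (proj i)
  have "term_op F N (\<lambda>xs. xs ! (is ! i))"
    using proj assms(2,3) by (intro term_op.proj) (metis lessThan_iff nth_mem subsetD)
  then show ?case using proj assms(2) by auto
next
  case (comp m f ts)
  then obtain r where
    r: "\<And>t. t \<in> set ts \<Longrightarrow> term_op F N (r t) \<and> (\<forall>xs. r t xs = t (map ((!) xs) is))"
    by metis
  have "term_op F N (\<lambda>xs. f (map (\<lambda>t. t xs) (map r ts)))"
    using comp(1,2) r by (intro term_op.comp) auto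
  moreover have "map (\<lambda>t. t xs) (map r ts) = map (\<lambda>t. t (map ((!) xs) is)) ts" for xs
    using r by simp
  ultimately show ?case by metis
qed

text \<open>Each element of a generated set comes with its own term and arguments. Finitely many of
  them can share the concatenation of their argument lists, each term reading only its own
  block.\<close>

lemma gen_common_args:
  assumes "set ys \<subseteq> gen F X"
  shows "\<exists>ts xs. (\<forall>t \<in> set ts. term_op F (length xs) t) \<and> set xs \<subseteq> X \<and> ys = map (\<lambda>t. t xs) ts"
  using assms
proof (induction ys)
  case Nil
  show ?case by (intro exI[of _ "[]"]) simp
next
  case (Cons y ys)
  then obtain ts xs where IH: "\<forall>t \<in> set ts. term_op F (length xs) t" "set xs \<subseteq> X"
    "ys = map (\<lambda>t. t xs) ts" by auto
  from Cons obtain s us where s: "term_op F (length us) s" "set us \<subseteq> X" "y = s us"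
    by (auto elim: genE)
  \<comment> \<open>The arguments \<open>us\<close> of the new element come first: \<open>s\<close>
    reads the block \<open>[0..<length us]\<close>, the earlier terms read the rest.\<close>
  let ?N = "length (us @ xs)"
  obtain s' where s': "term_op F ?N s'"
    "\<And>zs. s' zs = s (map ((!) zs) [0..<length us])"
    using term_op_reindex[OF s(1), of "[0..<length us]" ?N] by force
  have "\<exists>t'. term_op F ?N t' \<and> (\<forall>zs. t' zs = t (map ((!) zs) [length us..<?N]))"
    if "t \<in> set ts" for t
    using IH(1) that by (intro term_op_reindex) auto
  then obtain r where r: "\<And>t. t \<in> set ts \<Longrightarrow>
      term_op F ?N (r t) \<and> (\<forall>zs. r t zs = t (map ((!) zs) [length us..<?N]))"
    by metis
  have "map ((!) (us @ xs)) [0..<length us] = us"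
    by (rule nth_equalityI) (auto simp: nth_append)
  moreover have "map ((!) (us @ xs)) [length us..<?N] = xs"
    by (rule nth_equalityI) (auto simp: nth_append)
  ultimately have "y # ys = map (\<lambda>t. t (us @ xs)) (s' # map r ts)"
    using r s' s(3) IH(3) by simp
  moreover have "\<forall>t \<in> set (s' # map r ts). term_op F ?N t"
    using r s' by auto
  ultimately show ?case
    using s(2) IH(2) by (intro exI[of _ "s' # map r ts"] exI[of _ "us @ xs"]) auto
qed

text \<open>Once the arguments of an operation are terms in the same list \<open>xs\<close>,
  applying the operation is a single composition of terms.\<close>

lemma closed_gen: "closed_under F (gen F X)"
  unfolding closed_under_def
proof (clarify)
  fix f :: "'a list \<Rightarrow> 'a" and ys
  assume f: "(length ys, f) \<in> F" and "set ys \<subseteq> gen F X"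
  then obtain ts xs where ts: "\<forall>t \<in> set ts. term_op F (length xs) t" "set xs \<subseteq> X"
    "ys = map (\<lambda>t. t xs) ts" using gen_common_args by blast
  then have "term_op F (length xs) (\<lambda>xs. f (map (\<lambda>t. t xs) ts))"
    using f by (intro term_op.comp) auto
  from term_op_in_gen[OF this ts(2)] show "f ys \<in> gen F X" using ts(3) by simp
qed

lemma gen_closed_eq: "closed_under F S \<Longrightarrow> gen F S = S"
  by (intro subset_antisym gen_least subset_gen order_refl)

lemma gen_subset_gen: "X \<subseteq> gen F Y \<Longrightarrow> gen F X \<subseteq> gen F Y"
  by (rule gen_least[OF _ closed_gen])

lemma indep_mono:
  assumes "indep A F X" "Y \<subseteq> X"
  shows "indep A F Y"
proof -
  have "x \<notin> gen F (Y - {x})" if "x \<in> Y" for x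
    using assms that gen_monoD[of x F "Y - {x}" "X - {x}"] unfolding indep_def by blast
  then show ?thesis using assms unfolding indep_def by blast
qed

section \<open>Dimension under the exchange property\<close>

locale exchange_algebra =
  fixes A :: "'a set" and F :: "'a ops"
  assumes closed_univ: "closed_under F A"
    and exchange: "exchange_property A F"
begin

lemma gen_subset_univ: "X \<subseteq> A \<Longrightarrow> gen F X \<subseteq> A"
  by (rule gen_least[OF _ closed_univ])

text \<open>If some \<open>x\<close> in \<open>X\<close> depended on \<open>a\<close> and
  \<open>X - {x}\<close>, exchange would trade \<open>x\<close> for \<open>a\<close> and put
  \<open>a\<close> into \<open>gen F X\<close>.\<close>

lemma indep_insert:
  assumes X: "indep A F X" and a: "a \<in> A" "a \<notin> gen F X"
  shows "indep A F (insert a X)"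
proof -
  have XA: "X \<subseteq> A" using X unfolding indep_def by blast
  have "x \<notin> gen F (insert a X - {x})" if x: "x \<in> insert a X" for x
  proof (cases "x = a")
    case True
    have "insert a X - {a} \<subseteq> X" by blast
    then show ?thesis using True a gen_monoD[of a F "insert a X - {a}" X] by blast
  next
    case False
    then have "x \<in> X" using x by blast
    then have eqs: "insert a X - {x} = insert a (X - {x})" "insert x (X - {x}) = X"
      using False by auto
    show ?thesis
    proof
      assume "x \<in> gen F (insert a X - {x})"
      moreover have "x \<notin> gen F (X - {x})"
        using X \<open>x \<in> X\<close> unfolding indep_def by blast
      ultimately have "a \<in> gen F (insert x (X - {x}))"
        using exchange XA a(1) \<open>x \<in> X\<close> eqs(1) unfolding exchange_property_def
        by (metis Diff_subset subset_iff)
      then show False using a eqs(2) by simp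
    qed
  qed
  then show ?thesis using XA a unfolding indep_def by blast
qed

text \<open>Dependence has finite character: a dependence in the union involves finitely many
  elements, and these already lie in one member of the chain.\<close>

lemma indep_Union_chain:
  assumes C: "\<And>X. X \<in> C \<Longrightarrow> indep A F X" and chain: "subset.chain UNIV C"
  shows "indep A F (\<Union>C)"
  unfolding indep_def
proof (intro conjI ballI notI)
  show "\<Union>C \<subseteq> A" using C unfolding indep_def by blast
  fix x assume x: "x \<in> \<Union>C" "x \<in> gen F (\<Union>C - {x})"
  from gen_finite_subset[OF x(2)]
  obtain Y where Y: "finite Y" "Y \<subseteq> \<Union>C - {x}" "x \<in> gen F Y" .
  have "finite (insert x Y)" "insert x Y \<subseteq> \<Union>C" "C \<noteq> {}" using x Y by auto
  then obtain X where X: "X \<in> C" "insert x Y \<subseteq> X"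
    using chain by (metis finite_subset_Union_chain)
  then have "Y \<subseteq> X - {x}" using Y by blast
  then have "x \<in> gen F (X - {x})" using gen_monoD[OF Y(3)] by blast
  then show False using C[OF X(1)] X(2) unfolding indep_def by blast
qed

text \<open>Zorn's lemma gives a maximal independent set between \<open>X\<close> and
  \<open>Y\<close>; by \<open>indep_insert\<close> it generates all of \<open>Y\<close>. Empty
  \<open>X\<close> yields bases of subalgebras, and \<open>Y = A\<close> yields extensions to bases
  of the whole algebra.\<close>

lemma indep_extend:
  assumes X: "indep A F X" "X \<subseteq> Y" and Y: "Y \<subseteq> A"
  obtains Z where "indep A F Z" "X \<subseteq> Z" "Z \<subseteq> Y" "Y \<subseteq> gen F Z"
proof -
  let ?P = "{Z. indep A F Z \<and> X \<subseteq> Z \<and> Z \<subseteq> Y}"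
  have "\<exists>M \<in> ?P. \<forall>Z \<in> ?P. M \<subseteq> Z \<longrightarrow> Z = M"
  proof (rule subset_Zorn_nonempty)
    show "?P \<noteq> {}" using X by blast
    fix C assume C: "C \<noteq> {}" "subset.chain ?P C"
    then have sub: "C \<subseteq> ?P" and "subset.chain UNIV C"
      unfolding subset.chain_def by auto
    then have "indep A F (\<Union>C)" using indep_Union_chain by blast
    then show "\<Union>C \<in> ?P" using C(1) sub by blast
  qed
  then obtain M where M: "indep A F M" "X \<subseteq> M" "M \<subseteq> Y"
    and max: "\<And>Z. indep A F Z \<Longrightarrow> X \<subseteq> Z \<Longrightarrow> Z \<subseteq> Y \<Longrightarrow> M \<subseteq> Z \<Longrightarrow> Z = M"
    by (auto simp: Ball_def)
  have "y \<in> gen F M" if "y \<in> Y" for y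
  proof (rule ccontr)
    assume y: "y \<notin> gen F M"
    then have "indep A F (insert y M)" using indep_insert[OF M(1)] Y that by blast
    then have "insert y M = M" using max[of "insert y M"] M that by blast
    then show False using y subset_gen[of M F] by blast
  qed
  then have "Y \<subseteq> gen F M" by blast
  with M show thesis by (rule that)
qed

lemma basis_exists:
  assumes "is_subalgebra A F S"
  shows "\<exists>X. alg_basis A F S X"
proof -
  have S: "S \<subseteq> A" "closed_under F S" using assms unfolding is_subalgebra_def by auto
  have "indep A F {}" unfolding indep_def by simp
  from indep_extend[OF this empty_subsetI S(1)]
  obtain Z where "indep A F Z" "Z \<subseteq> S" "S \<subseteq> gen F Z" .
  then have "alg_basis A F S Z"
    using gen_least[OF _ S(2)] unfolding alg_basis_def by blast
  then show ?thesis by blast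
qed

text \<open>Replacing the elements of \<open>X - Y\<close> one by one by elements of \<open>Y\<close> reduces to \<open>X \<subseteq> Y\<close>.\<close>

lemma card_indep_le_aux:
  assumes "indep A F X" "finite X" "finite Y" "Y \<subseteq> A" "X \<subseteq> gen F Y"
  shows "card X \<le> card Y"
  using assms
proof (induction "card (X - Y)" arbitrary: X rule: less_induct)
  case less
  show ?case
  proof (cases "X \<subseteq> Y")
    case True
    then show ?thesis using less card_mono by blast
  next
    case False
    then obtain x where x: "x \<in> X" "x \<notin> Y" by blast
    have x': "x \<notin> gen F (X - {x})" using less.prems(1) x unfolding indep_def by blast
    \<comment> \<open>Otherwise \<open>gen F Y\<close>, and with it \<open>x\<close>, would lie in
      \<open>gen F (X - {x})\<close>.\<close>
    then have "\<not> Y \<subseteq> gen F (X - {x})"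
      using less.prems(5) x gen_subset_gen[of Y F "X - {x}"] by blast
    then obtain y where y: "y \<in> Y" "y \<notin> gen F (X - {x})" by blast
    then have yX: "y \<notin> X" using x subset_gen[of "X - {x}" F] by blast
    let ?X = "insert y (X - {x})"
    have "indep A F ?X"
      using indep_insert[OF indep_mono[OF less.prems(1) Diff_subset] _ y(2)] y(1) less.prems(4)
      by blast
    moreover have "?X \<subseteq> gen F Y" using less.prems(5) y subset_gen[of Y F] by blast
    \<comment> \<open>The removed \<open>x\<close> lies outside \<open>Y\<close> and the added
      \<open>y\<close> inside, so the measure drops.\<close>
    moreover have "card (?X - Y) < card (X - Y)"
      using x y less.prems(2) by (intro psubset_card_mono) auto
    ultimately have "card ?X \<le> card Y"
      using less.hyps[of ?X] less.prems(2-4) by simp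
    moreover have "card ?X = Suc (card (X - {x}))" using yX less.prems(2) by simp
    then have "card ?X = card X" using card_Suc_Diff1[OF less.prems(2) x(1)] by simp
    ultimately show ?thesis by simp
  qed
qed

text \<open>An infinite \<open>X\<close> would contain a finite independent subset with one element
  more than \<open>Y\<close>.\<close>

lemma finite_indep:
  assumes "indep A F X" "finite Y" "Y \<subseteq> A" "X \<subseteq> gen F Y"
  shows "finite X"
proof (rule ccontr)
  assume "infinite X"
  then obtain Z where Z: "Z \<subseteq> X" "finite Z" "card Z = Suc (card Y)"
    using infinite_arbitrarily_large by blast
  then have "card Z \<le> card Y"
    using card_indep_le_aux[OF indep_mono[OF assms(1) Z(1)] Z(2)] assms by auto
  then show False using Z by simp
qed

text \<open>Finite \<open>Y\<close> is settled by the exchange count. For infinite \<open>Y\<close>,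
  extend \<open>X\<close> to an independent \<open>Z\<close> inside \<open>X \<union> Y\<close>.
  Each \<open>y\<close> needs only finitely many elements of \<open>Z\<close>; the union of these
  supports generates \<open>Z\<close>, so by independence it exhausts \<open>Z\<close>, and it has
  at most as many elements as \<open>Y\<close>.\<close>

lemma card_indep_le:
  assumes X: "indep A F X" and Y: "Y \<subseteq> A" and XY: "X \<subseteq> gen F Y"
  shows "|X| \<le>o |Y|"
proof (cases "finite Y")
  case True
  then have "finite X" using finite_indep[OF X _ Y XY] by blast
  then show ?thesis
    using card_indep_le_aux[OF X _ True Y XY] True inj_on_iff_card_le[of X Y] card_of_ordLeq[of X Y]
    by blast
next
  case False
  have XA: "X \<subseteq> A" using X unfolding indep_def by blast
  have "X \<union> Y \<subseteq> A" using XA Y by blast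
  from indep_extend[OF X Un_upper1 this]
  obtain Z where Z: "indep A F Z" "X \<subseteq> Z" "Z \<subseteq> X \<union> Y" "X \<union> Y \<subseteq> gen F Z" .
  have "\<exists>W. finite W \<and> W \<subseteq> Z \<and> y \<in> gen F W" if "y \<in> Y" for y
  proof -
    have "y \<in> gen F Z" using Z(4) that by blast
    then show ?thesis by (rule gen_finite_subset) blast
  qed
  then have "\<forall>y \<in> Y. \<exists>W. finite W \<and> W \<subseteq> Z \<and> y \<in> gen F W" by simp
  from bchoice[OF this] obtain W
    where "\<forall>y \<in> Y. finite (W y) \<and> W y \<subseteq> Z \<and> y \<in> gen F (W y)" ..
  then have W: "finite (W y)" "W y \<subseteq> Z" "y \<in> gen F (W y)" if "y \<in> Y" for y
    using that by simp_all
  let ?U = "\<Union>y \<in> Y. W y"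
  have "Y \<subseteq> gen F ?U"
  proof
    fix y assume y: "y \<in> Y"
    have "W y \<subseteq> ?U" using y by blast
    with W(3)[OF y] show "y \<in> gen F ?U" by (rule gen_monoD)
  qed
  from gen_subset_gen[OF this] have "gen F Y \<subseteq> gen F ?U" .
  moreover have "Z \<subseteq> gen F Y" using Z(3) XY subset_gen[of Y F] by blast
  ultimately have ZU: "Z \<subseteq> gen F ?U" by blast
  have "Z \<subseteq> ?U"
  proof (rule ccontr)
    assume "\<not> Z \<subseteq> ?U"
    then obtain z where z: "z \<in> Z" "z \<notin> ?U" by blast
    then have "?U \<subseteq> Z - {z}" using W by blast
    then have "z \<in> gen F (Z - {z})" using gen_monoD[of z F ?U] ZU z(1) by blast
    then show False using Z(1) z unfolding indep_def by blast
  qed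
  moreover have "|?U| \<le>o |Y|"
  proof (rule card_of_UNION_ordLeq_infinite[OF False])
    show "|Y| \<le>o |Y|" by (rule card_of_mono1) simp
    show "\<forall>y \<in> Y. |W y| \<le>o |Y|"
    proof
      fix y assume "y \<in> Y"
      then show "|W y| \<le>o |Y|"
        using ordLess_imp_ordLeq[OF finite_ordLess_infinite[OF
            card_of_Well_order[of "W y"] card_of_Well_order[of Y]]] W(1) False
        by (simp add: Field_card_of)
    qed
  qed
  moreover have "|X| \<le>o |?U|" if "Z \<subseteq> ?U" using Z(2) that by (intro card_of_mono1) blast
  ultimately show ?thesis by (blast intro: ordLeq_transitive)
qed

section \<open>Dimension of subalgebras and its monotonicity\<close>

lemma alg_dim_basis:
  assumes "is_subalgebra A F S"
  obtains X where "alg_basis A F S X" "alg_dim A F S = |X|"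
  using someI_ex[OF basis_exists[OF assms]] unfolding alg_dim_def by blast

text \<open>\<open>Y\<close> may lie outside \<open>S\<close>: for monotonicity it is a basis of a
  larger subalgebra, for images it is the image of a basis.\<close>

lemma alg_dim_le_card:
  assumes "is_subalgebra A F S" "Y \<subseteq> A" "S \<subseteq> gen F Y"
  shows "alg_dim A F S \<le>o |Y|"
proof -
  obtain X where X: "alg_basis A F S X" "alg_dim A F S = |X|"
    by (rule alg_dim_basis[OF assms(1)])
  then have "indep A F X" "X \<subseteq> gen F Y"
    using assms(3) subset_gen[of X F] unfolding alg_basis_def by auto
  then show ?thesis using card_indep_le[of X Y] assms(2) X(2) by simp
qed

lemma alg_dim_mono:
  assumes "is_subalgebra A F S" "is_subalgebra A F S'" "S \<subseteq> S'"
  shows "alg_dim A F S \<le>o alg_dim A F S'"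
proof -
  obtain X where X: "alg_basis A F S' X" "alg_dim A F S' = |X|"
    by (rule alg_dim_basis[OF assms(2)])
  then show ?thesis
    using alg_dim_le_card[OF assms(1), of X] assms(3) unfolding alg_basis_def indep_def by simp
qed

end

section \<open>Endomorphisms\<close>

lemma endosD: "\<alpha> \<in> endos A F \<Longrightarrow> \<alpha> \<in> A \<rightarrow>\<^sub>E A"
  unfolding endos_def by blast

lemma endos_intoD:
  "\<alpha> \<in> endos_into A F B \<Longrightarrow> \<alpha> \<in> endos A F"
  "\<alpha> \<in> endos_into A F B \<Longrightarrow> a \<in> A \<Longrightarrow> \<alpha> a \<in> B"
  unfolding endos_into_def by auto

lemma then_map_apply [simp]: "a \<in> A \<Longrightarrow> then_map A \<alpha> \<beta> a = \<beta> (\<alpha> a)"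
  unfolding then_map_def by (rule compose_eq)

context exchange_algebra
begin

lemma endos_term_op:
  assumes "\<alpha> \<in> endos A F" "term_op F n t" "length xs = n" "set xs \<subseteq> A"
  shows "\<alpha> (t xs) = t (map \<alpha> xs)"
  using assms(2)
proof induction
  case (proj i)
  then show ?case using assms(3) by simp
next
  case (comp m f ts)
  let ?ys = "map (\<lambda>t. t xs) ts"
  have "set ?ys \<subseteq> A"
    using comp term_op_closed closed_univ assms(3,4) by fastforce
  then have "\<alpha> (f ?ys) = f (map \<alpha> ?ys)"
    using assms(1) comp(1,2) unfolding endos_def by fastforce
  also have "map \<alpha> ?ys = map (\<lambda>t. t (map \<alpha> xs)) ts"
    using comp by simp
  finally show ?case .
qed

lemma endos_image_gen:
  assumes \<alpha>: "\<alpha> \<in> endos A F" and X: "X \<subseteq> A"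
  shows "\<alpha> ` gen F X = gen F (\<alpha> ` X)"
proof (intro subset_antisym subsetI)
  fix y assume "y \<in> \<alpha> ` gen F X"
  then obtain t xs where t: "term_op F (length xs) t" "set xs \<subseteq> X" "y = \<alpha> (t xs)"
    by (auto elim: genE)
  then have "y = t (map \<alpha> xs)" using endos_term_op[OF \<alpha>] X by blast
  then show "y \<in> gen F (\<alpha> ` X)"
    using t term_op_in_gen[of F "map \<alpha> xs" t "\<alpha> ` X"] by auto
next
  fix y assume "y \<in> gen F (\<alpha> ` X)"
  then obtain t ys where t: "term_op F (length ys) t" "set ys \<subseteq> \<alpha> ` X" "y = t ys"
    by (rule genE)
  \<comment> \<open>A list over the image of \<open>X\<close> is the image of a list over
    \<open>X\<close>, which selects preimages for all arguments at once.\<close>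
  have "ys \<in> map \<alpha> ` lists X" using t(2) unfolding lists_image[symmetric] by auto
  then obtain xs where xs: "set xs \<subseteq> X" "ys = map \<alpha> xs" by auto
  then have "y = \<alpha> (t xs)" using endos_term_op[OF \<alpha>, of "length xs" t xs] X t by auto
  moreover have "t xs \<in> gen F X" using t xs by (auto intro: term_op_in_gen)
  ultimately show "y \<in> \<alpha> ` gen F X" by blast
qed

lemma is_subalgebra_image:
  assumes \<alpha>: "\<alpha> \<in> endos A F" and S: "is_subalgebra A F S"
  shows "is_subalgebra A F (\<alpha> ` S)"
proof -
  have S': "S \<subseteq> A" "gen F S = S"
    using S gen_closed_eq unfolding is_subalgebra_def by auto
  then have "\<alpha> ` S = gen F (\<alpha> ` S)" using endos_image_gen[OF \<alpha>, of S] by simp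
  moreover have "\<alpha> ` S \<subseteq> A" using S'(1) endosD[OF \<alpha>] by auto
  ultimately show ?thesis
    using closed_gen[of F "\<alpha> ` S"] unfolding is_subalgebra_def by simp
qed

lemma is_subalgebra_univ: "is_subalgebra A F A"
  using closed_univ unfolding is_subalgebra_def by blast

lemma alg_dim_image_le:
  assumes \<alpha>: "\<alpha> \<in> endos A F" and S: "is_subalgebra A F S"
  shows "alg_dim A F (\<alpha> ` S) \<le>o alg_dim A F S"
proof -
  obtain X where X: "alg_basis A F S X" "alg_dim A F S = |X|"
    by (rule alg_dim_basis[OF S])
  then have "X \<subseteq> A" "gen F X = S" unfolding alg_basis_def indep_def by auto
  then have "\<alpha> ` S \<subseteq> gen F (\<alpha> ` X)" "\<alpha> ` X \<subseteq> A"
    using endos_image_gen[OF \<alpha>, of X] endosD[OF \<alpha>] by auto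
  then have "alg_dim A F (\<alpha> ` S) \<le>o |\<alpha> ` X|"
    using alg_dim_le_card[OF is_subalgebra_image[OF assms]] by blast
  then show ?thesis unfolding X(2) using card_of_image by (rule ordLeq_transitive)
qed

text \<open>This will turn a composite that fixes a basis of the image of \<alpha> into one that
  fixes the whole image.\<close>

lemma endos_fix_gen:
  assumes "\<alpha> \<in> endos A F" "X \<subseteq> A" "\<And>x. x \<in> X \<Longrightarrow> \<alpha> x = x" "y \<in> gen F X"
  shows "\<alpha> y = y"
proof -
  obtain t xs where t: "term_op F (length xs) t" "set xs \<subseteq> X" "y = t xs"
    using assms(4) by (rule genE)
  then have "map \<alpha> xs = xs" using assms(3) by (auto intro: map_idI)
  then show ?thesis using endos_term_op[OF assms(1) t(1)] t assms(2) by auto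
qed

lemma then_map_endos:
  assumes \<alpha>: "\<alpha> \<in> endos A F" and \<beta>: "\<beta> \<in> endos A F"
  shows "then_map A \<alpha> \<beta> \<in> endos A F"
proof -
  have "then_map A \<alpha> \<beta> \<in> A \<rightarrow>\<^sub>E A"
    using endosD[OF \<alpha>] endosD[OF \<beta>] unfolding then_map_def compose_def by auto
  moreover have "then_map A \<alpha> \<beta> (f xs) = f (map (then_map A \<alpha> \<beta>) xs)"
    if f: "(n, f) \<in> F" and xs: "length xs = n" "set xs \<subseteq> A" for n f xs
  proof -
    have "f xs \<in> A" using f xs closed_univ unfolding closed_under_def by blast
    moreover have "\<alpha> (f xs) = f (map \<alpha> xs)"
      using \<alpha> f xs unfolding endos_def by blast
    moreover have "set (map \<alpha> xs) \<subseteq> A" using endosD[OF \<alpha>] xs(2) by auto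
    then have "\<beta> (f (map \<alpha> xs)) = f (map \<beta> (map \<alpha> xs))"
      using \<beta> f xs unfolding endos_def by fastforce
    moreover have "map \<beta> (map \<alpha> xs) = map (then_map A \<alpha> \<beta>) xs" using xs(2) by auto
    ultimately show ?thesis by (simp del: map_map)
  qed
  ultimately show ?thesis unfolding endos_def by blast
qed

text \<open>Composition restricts to \<open>A\<close>; since \<alpha> maps \<open>A\<close> into
  \<open>A\<close>, the inner restriction on the right-hand side changes nothing.\<close>

lemma then_map_assoc:
  assumes "\<alpha> \<in> endos A F"
  shows "then_map A (then_map A \<alpha> \<beta>) \<gamma> = then_map A \<alpha> (then_map A \<beta> \<gamma>)"
  using endosD[OF assms] unfolding then_map_def compose_def by (auto simp: fun_eq_iff restrict_def)

lemma endos_eqI: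
  assumes "\<alpha> \<in> endos A F" "\<beta> \<in> endos A F" "\<And>a. a \<in> A \<Longrightarrow> \<alpha> a = \<beta> a"
  shows "\<alpha> = \<beta>"
  using assms endosD by (metis PiE_ext)

end

section \<open>The semigroup of endomorphisms into a subalgebra\<close>

lemma monoid_adjoin_one:
  assumes "\<And>a b. a \<in> S \<Longrightarrow> b \<in> S \<Longrightarrow> mul a b \<in> S"
    and "\<And>a b c. a \<in> S \<Longrightarrow> b \<in> S \<Longrightarrow> c \<in> S \<Longrightarrow> mul (mul a b) c = mul a (mul b c)"
  shows "monoid (adjoin_one S mul)"
  by (rule monoidI) (auto simp: adjoin_one_def assms)

text \<open>A principal ideal is contained in another exactly when its generator belongs to the
  other, by associativity and the presence of an identity.\<close>

lemma green_J_iff: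
  fixes S mul
  defines "M \<equiv> adjoin_one S mul"
  assumes M: "monoid M" and ab: "a \<in> S" "b \<in> S"
  shows "green_J S mul a b \<longleftrightarrow>
    (\<exists>x \<in> carrier M. \<exists>y \<in> carrier M. Some a = x \<otimes>\<^bsub>M\<^esub> Some b \<otimes>\<^bsub>M\<^esub> y) \<and>
    (\<exists>x \<in> carrier M. \<exists>y \<in> carrier M. Some b = x \<otimes>\<^bsub>M\<^esub> Some a \<otimes>\<^bsub>M\<^esub> y)"
    (is "_ \<longleftrightarrow> ?le a b \<and> ?le b a")
proof -
  interpret monoid M by fact
  have I: "principal_ideal S mul c =
      {x \<otimes>\<^bsub>M\<^esub> Some c \<otimes>\<^bsub>M\<^esub> y | x y. x \<in> carrier M \<and> y \<in> carrier M}" for c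
    unfolding principal_ideal_def M_def Let_def ..
  have carr: "Some c \<in> carrier M" if "c \<in> S" for c
    using that unfolding M_def adjoin_one_def by simp
  have le: "?le c d \<longleftrightarrow> principal_ideal S mul c \<subseteq> principal_ideal S mul d"
    if cd: "c \<in> S" "d \<in> S" for c d
  proof
    assume "?le c d"
    then obtain x y where xy: "x \<in> carrier M" "y \<in> carrier M"
      "Some c = x \<otimes>\<^bsub>M\<^esub> Some d \<otimes>\<^bsub>M\<^esub> y" by blast
    show "principal_ideal S mul c \<subseteq> principal_ideal S mul d"
    proof
      fix z assume "z \<in> principal_ideal S mul c"
      then obtain u v where uv: "u \<in> carrier M" "v \<in> carrier M"
        "z = u \<otimes>\<^bsub>M\<^esub> Some c \<otimes>\<^bsub>M\<^esub> v" unfolding I by blast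
      then have "z = (u \<otimes>\<^bsub>M\<^esub> x) \<otimes>\<^bsub>M\<^esub> Some d \<otimes>\<^bsub>M\<^esub> (y \<otimes>\<^bsub>M\<^esub> v)"
        using xy carr[OF cd(2)] by (simp add: m_assoc)
      then show "z \<in> principal_ideal S mul d" unfolding I using xy uv by blast
    qed
  next
    assume "principal_ideal S mul c \<subseteq> principal_ideal S mul d"
    moreover have "Some c = \<one>\<^bsub>M\<^esub> \<otimes>\<^bsub>M\<^esub> Some c \<otimes>\<^bsub>M\<^esub> \<one>\<^bsub>M\<^esub>" using carr[OF cd(1)] by simp
    then have "Some c \<in> principal_ideal S mul c" unfolding I by blast
    ultimately show "?le c d" unfolding I by blast
  qed
  show ?thesis unfolding green_J_def using le ab by blast
qed

section \<open>Extension of maps and factorisation criteria\<close>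

locale subalgebra_semigroup = exchange_algebra +
  fixes B :: "'a set"
  assumes free: "free_basis_property A F"
    and subalg: "is_subalgebra A F B"
    and nonempty: "B \<noteq> {}"
begin

abbreviation "T \<equiv> endos_into A F B"
abbreviation "T1 \<equiv> adjoin_one T (then_map A)"

lemma subset_univ: "B \<subseteq> A"
  using subalg unfolding is_subalgebra_def by blast

lemma then_map_T: "\<alpha> \<in> T \<Longrightarrow> \<beta> \<in> T \<Longrightarrow> then_map A \<alpha> \<beta> \<in> T"
  using then_map_endos endos_intoD subset_univ unfolding endos_into_def by (auto simp: subset_iff)

sublocale T1: monoid T1
  by (rule monoid_adjoin_one) (auto simp: then_map_T then_map_assoc endos_intoD)

lemma T1_carrier: "carrier T1 = insert None (Some ` T)"
  unfolding adjoin_one_def by simp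

lemma T1_mult [simp]:
  "None \<otimes>\<^bsub>T1\<^esub> y = y" "x \<otimes>\<^bsub>T1\<^esub> None = x"
  "Some \<alpha> \<otimes>\<^bsub>T1\<^esub> Some \<beta> = Some (then_map A \<alpha> \<beta>)"
  unfolding adjoin_one_def by (auto split: option.split)

lemma indep_map_extend:
  assumes X: "indep A F X" and g: "g \<in> X \<rightarrow> B"
  obtains \<mu> where "\<mu> \<in> T" "\<And>x. x \<in> X \<Longrightarrow> \<mu> x = g x"
proof -
  obtain b where b: "b \<in> B" using nonempty by blast
  have "X \<subseteq> A" using X unfolding indep_def by blast
  from indep_extend[OF X this order_refl]
  obtain Z where Z: "indep A F Z" "X \<subseteq> Z" "Z \<subseteq> A" "A \<subseteq> gen F Z" .
  have gen: "gen F Z = A" using gen_subset_univ[OF Z(3)] Z(4) by blast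
  \<comment> \<open>Basis elements outside \<open>X\<close> go to the default value \<open>b\<close>
    in \<open>B\<close>, so that the whole image of the extension stays in \<open>B\<close>.\<close>
  let ?g = "\<lambda>x. if x \<in> X then g x else b"
  have gB: "?g z \<in> B" for z using g b by auto
  then have "?g \<in> Z \<rightarrow> A" using subset_univ by blast
  moreover have "alg_basis A F A Z" using Z gen unfolding alg_basis_def by blast
  ultimately obtain \<mu> where \<mu>: "\<mu> \<in> endos A F" "\<And>x. x \<in> Z \<Longrightarrow> \<mu> x = ?g x"
    using free unfolding free_basis_property_def by blast
  have "\<mu> ` A = gen F (\<mu> ` Z)" using endos_image_gen[OF \<mu>(1) Z(3)] gen by simp
  also have "\<dots> \<subseteq> B"
    using \<mu>(2) gB subalg unfolding is_subalgebra_def by (intro gen_least image_subsetI) metis+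
  finally have "\<mu> \<in> T" using \<mu>(1) unfolding endos_into_def by blast
  moreover have "\<mu> x = g x" if "x \<in> X" for x using \<mu>(2) Z(2) that by auto
  ultimately show thesis by (rule that)
qed

text \<open>The left factor sends \<open>A\<close> into \<open>B\<close>, so the image of \<alpha>
  sits inside the image of \<open>B\<close> under \<beta> and the right factor, and the right factor
  cannot raise dimension.\<close>

lemma map_rank_le_of_factor:
  assumes "\<gamma> \<in> T" "\<beta> \<in> T" "\<mu> \<in> carrier T1" "\<alpha> \<in> T"
    and eq: "Some \<alpha> = Some \<gamma> \<otimes>\<^bsub>T1\<^esub> Some \<beta> \<otimes>\<^bsub>T1\<^esub> \<mu>"
  shows "map_rank A F \<alpha> \<le>o alg_dim A F (\<beta> ` B)"
proof -
  note T = assms(1-4)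
  have sub: "is_subalgebra A F (\<alpha> ` A)" "is_subalgebra A F (\<beta> ` B)"
    using is_subalgebra_image[OF endos_intoD(1)[OF T(4)] is_subalgebra_univ]
      is_subalgebra_image[OF endos_intoD(1)[OF T(2)] subalg] by simp_all
  show ?thesis
  proof (cases \<mu>)
    case None
    then have "\<alpha> = then_map A \<gamma> \<beta>" using eq by simp
    then have "\<alpha> ` A \<subseteq> \<beta> ` B" using endos_intoD(2)[OF T(1)] by auto
    then show ?thesis unfolding map_rank_def by (rule alg_dim_mono[OF sub])
  next
    case (Some \<nu>)
    then have \<nu>: "\<nu> \<in> T" "\<alpha> = then_map A (then_map A \<gamma> \<beta>) \<nu>"
      using eq T(3) T1_carrier by auto
    then have "\<alpha> ` A \<subseteq> \<nu> ` \<beta> ` B"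
      using endos_intoD(2)[OF T(1)] by auto
    moreover have "is_subalgebra A F (\<nu> ` \<beta> ` B)"
      using is_subalgebra_image[OF endos_intoD(1)[OF \<nu>(1)] sub(2)] .
    ultimately have "map_rank A F \<alpha> \<le>o alg_dim A F (\<nu> ` \<beta> ` B)"
      using alg_dim_mono[OF sub(1)] unfolding map_rank_def by blast
    also have "alg_dim A F (\<nu> ` \<beta> ` B) \<le>o alg_dim A F (\<beta> ` B)"
      using alg_dim_image_le[OF endos_intoD(1)[OF \<nu>(1)] sub(2)] .
    finally show ?thesis .
  qed
qed

lemma factor_of_map_rank_le:
  assumes T: "\<alpha> \<in> T" "\<beta> \<in> T" and le: "map_rank A F \<alpha> \<le>o alg_dim A F (\<beta> ` B)"
  obtains \<gamma> \<mu> where "\<gamma> \<in> T" "\<mu> \<in> T" "\<alpha> = then_map A (then_map A \<gamma> \<beta>) \<mu>"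
proof -
  have sub: "is_subalgebra A F (\<alpha> ` A)" "is_subalgebra A F (\<beta> ` B)"
    using is_subalgebra_image[OF endos_intoD(1)[OF T(1)] is_subalgebra_univ]
      is_subalgebra_image[OF endos_intoD(1)[OF T(2)] subalg] by simp_all
  obtain Y where Y: "alg_basis A F (\<alpha> ` A) Y" "map_rank A F \<alpha> = |Y|"
    unfolding map_rank_def by (rule alg_dim_basis[OF sub(1)])
  obtain Z where Z: "alg_basis A F (\<beta> ` B) Z" "alg_dim A F (\<beta> ` B) = |Z|"
    by (rule alg_dim_basis[OF sub(2)])
  have iY: "indep A F Y" "gen F Y = \<alpha> ` A" "Y \<subseteq> A" "Y \<subseteq> B"
    using Y(1) endos_intoD(2)[OF T(1)] subset_gen[of Y F]
    unfolding alg_basis_def indep_def by auto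
  have iZ: "indep A F Z" "Z \<subseteq> \<beta> ` B"
    using Z(1) subset_gen[of Z F] unfolding alg_basis_def by auto
  from le Y(2) Z(2) obtain h where h: "inj_on h Y" "h ` Y \<subseteq> Z"
    using card_of_ordLeq[of Y Z] by auto
  \<comment> \<open>The set \<open>Z\<close> lies in the image of \<open>B\<close>, not merely of
    \<open>A\<close>, so the preimages can be taken in \<open>B\<close>.\<close>
  have "\<forall>y \<in> Y. \<exists>b \<in> B. \<beta> b = h y" using h(2) iZ(2) by (metis image_iff subsetD)
  then obtain p where p: "\<And>y. y \<in> Y \<Longrightarrow> p y \<in> B \<and> \<beta> (p y) = h y" by metis
  have "p \<in> Y \<rightarrow> B" using p by blast
  from indep_map_extend[OF iY(1) this]
  obtain \<delta> where \<delta>: "\<delta> \<in> T" "\<And>y. y \<in> Y \<Longrightarrow> \<delta> y = p y" by blast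
  \<comment> \<open>The image of \<open>Y\<close> under \<open>h\<close> is part of the basis
    \<open>Z\<close>, hence independent, so \<mu> may be prescribed on it as the inverse of
    \<open>h\<close>.\<close>
  have "inv_into Y h \<in> h ` Y \<rightarrow> B" using iY(4) inv_into_into[of _ h Y] by blast
  from indep_map_extend[OF indep_mono[OF iZ(1) h(2)] this]
  obtain \<mu> where \<mu>: "\<mu> \<in> T" "\<And>z. z \<in> h ` Y \<Longrightarrow> \<mu> z = inv_into Y h z" by blast
  \<comment> \<open>This composite fixes the basis \<open>Y\<close>, hence every value of \<alpha>;
    putting \<alpha> in front of it therefore gives \<alpha> back.\<close>
  let ?\<phi> = "then_map A (then_map A \<delta> \<beta>) \<mu>"
  have "?\<phi> y = y" if "y \<in> Y" for y
  proof -
    have "?\<phi> y = \<mu> (\<beta> (\<delta> y))" using iY(3) that by auto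
    also have "\<dots> = inv_into Y h (h y)" using \<delta>(2) \<mu>(2) p that by simp
    finally show ?thesis using h(1) that by simp
  qed
  moreover note E = T[THEN endos_intoD(1)] \<delta>(1)[THEN endos_intoD(1)] \<mu>(1)[THEN endos_intoD(1)]
  then have "?\<phi> \<in> endos A F" by (simp add: then_map_endos)
  ultimately have fixed: "?\<phi> (\<alpha> a) = \<alpha> a" if "a \<in> A" for a
    using endos_fix_gen[of ?\<phi> Y "\<alpha> a"] iY(2,3) that by blast
  have "\<alpha> = then_map A (then_map A (then_map A \<alpha> \<delta>) \<beta>) \<mu>"
  proof (rule endos_eqI)
    fix a assume a: "a \<in> A"
    then have "\<alpha> a \<in> A" using endos_intoD(2)[OF T(1)] subset_univ by blast
    then show "\<alpha> a = then_map A (then_map A (then_map A \<alpha> \<delta>) \<beta>) \<mu> a"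
      using fixed[OF a] a by simp
  qed (simp_all add: then_map_endos E)
  with then_map_T[OF T(1) \<delta>(1)] \<mu>(1) show thesis by (rule that)
qed

lemma factor_iff_map_rank_le:
  assumes "\<alpha> \<in> T" "\<beta> \<in> T"
  shows "(\<exists>\<gamma> \<in> T. \<exists>\<mu> \<in> carrier T1. Some \<alpha> = Some \<gamma> \<otimes>\<^bsub>T1\<^esub> Some \<beta> \<otimes>\<^bsub>T1\<^esub> \<mu>)
    \<longleftrightarrow> map_rank A F \<alpha> \<le>o alg_dim A F (\<beta> ` B)" (is "?L \<longleftrightarrow> ?R")
proof
  assume ?L
  then show ?R using map_rank_le_of_factor[OF _ assms(2) _ assms(1)] by blast
next
  assume ?R
  from factor_of_map_rank_le[OF assms this]
  obtain \<gamma> \<mu> where "\<gamma> \<in> T" "\<mu> \<in> T" "\<alpha> = then_map A (then_map A \<gamma> \<beta>) \<mu>" .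
  then show ?L
    by (intro bexI[of _ \<gamma>] bexI[of _ "Some \<mu>"]) (auto simp: T1_carrier)
qed

text \<open>On a basis of the image of \<alpha>, choose \<alpha>-preimages and let \<mu> send each
  basis element to the \<beta>-value of its preimage. The kernel inclusion makes the result
  independent of the chosen preimages.\<close>

lemma right_factor_of_ker_subset:
  assumes T: "\<alpha> \<in> T" "\<beta> \<in> T" and ker: "map_ker A \<alpha> \<subseteq> map_ker A \<beta>"
  obtains \<mu> where "\<mu> \<in> T" "\<beta> = then_map A \<alpha> \<mu>"
proof -
  note E = endos_intoD(1)[OF T(1)] endos_intoD(1)[OF T(2)]
  obtain Y where "alg_basis A F (\<alpha> ` A) Y"
    using basis_exists[OF is_subalgebra_image[OF E(1) is_subalgebra_univ]] by blast
  then have Y: "indep A F Y" "gen F Y = \<alpha> ` A" "Y \<subseteq> A" "Y \<subseteq> \<alpha> ` A"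
    using subset_gen[of Y F] unfolding alg_basis_def indep_def by auto
  then have "\<forall>y \<in> Y. \<exists>x \<in> A. \<alpha> x = y" by blast
  then obtain p where p: "\<And>y. y \<in> Y \<Longrightarrow> p y \<in> A \<and> \<alpha> (p y) = y" by metis
  then have "(\<lambda>y. \<beta> (p y)) \<in> Y \<rightarrow> B" using endos_intoD(2)[OF T(2)] by blast
  from indep_map_extend[OF Y(1) this]
  obtain \<mu> where \<mu>: "\<mu> \<in> T" "\<And>y. y \<in> Y \<Longrightarrow> \<mu> y = \<beta> (p y)" by blast
  have "\<beta> = then_map A \<alpha> \<mu>"
  proof (rule endos_eqI)
    fix a assume a: "a \<in> A"
    then have "\<alpha> a \<in> gen F Y" using Y(2) by blast
    then obtain t ys where t: "term_op F (length ys) t" "set ys \<subseteq> Y" "\<alpha> a = t ys"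
      by (rule genE)
    \<comment> \<open>Applying \<open>t\<close> to the chosen preimages gives another element with
      the same \<alpha>-value as \<open>a\<close>, hence with the same \<beta>-value, and there
      \<beta> can be computed argument by argument.\<close>
    let ?xs = "map p ys"
    have xs: "set ?xs \<subseteq> A" "map \<alpha> ?xs = ys" using p t(2) by (auto intro!: map_idI)
    have t': "term_op F (length ?xs) t" using t(1) by simp
    have tA: "t ?xs \<in> A" using term_op_closed[OF t' closed_univ refl xs(1)] .
    have "\<alpha> (t ?xs) = \<alpha> a" using endos_term_op[OF E(1) t' refl xs(1)] xs(2) t(3) by simp
    then have "\<beta> a = \<beta> (t ?xs)" using ker a tA unfolding map_ker_def by auto
    also have "\<dots> = t (map \<beta> ?xs)" using endos_term_op[OF E(2) t' refl xs(1)] .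
    also have "map \<beta> ?xs = map \<mu> ys" using \<mu>(2) t(2) by auto
    also have "t (map \<mu> ys) = \<mu> (t ys)"
      using endos_term_op[OF endos_intoD(1)[OF \<mu>(1)] t(1)] t(2) Y(3) by auto
    finally show "\<beta> a = then_map A \<alpha> \<mu> a" using t(3) a by simp
  qed (simp_all add: then_map_endos E endos_intoD(1)[OF \<mu>(1)])
  with \<mu>(1) show thesis by (rule that)
qed

section \<open>Kernels, cycles of factorisations and Green's relation\<close>

lemma map_ker_right_factor:
  assumes "\<mu> \<in> carrier T1" "Some \<beta> = Some \<alpha> \<otimes>\<^bsub>T1\<^esub> \<mu>"
  shows "map_ker A \<alpha> \<subseteq> map_ker A \<beta>"
  using assms by (cases \<mu>) (auto simp: map_ker_def)

text \<open>Since \<open>T\<close> is an ideal of \<open>T1\<close>, a factor from \<open>T\<close>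
  stays in \<open>T\<close> after absorbing one that may be the adjoined identity.\<close>

lemma Some_T_ideal:
  assumes "\<gamma> \<in> T" "x \<in> carrier T1"
  shows "\<exists>\<delta> \<in> T. x \<otimes>\<^bsub>T1\<^esub> Some \<gamma> = Some \<delta>" "\<exists>\<delta> \<in> T. Some \<gamma> \<otimes>\<^bsub>T1\<^esub> x = Some \<delta>"
  using assms by (auto simp: T1_carrier then_map_T)

text \<open>Here \<open>l'\<close> may be the adjoined identity. Substituting one equation into the
  other makes \<gamma> part of every left factor, as \<open>map_rank_le_of_factor\<close>
  requires.\<close>

lemma map_rank_le_of_cycle:
  assumes T: "\<alpha> \<in> T" "\<beta> \<in> T" "\<gamma> \<in> T"
    and car: "m \<in> carrier T1" "l' \<in> carrier T1" "m' \<in> carrier T1"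
    and eq: "Some \<alpha> = Some \<gamma> \<otimes>\<^bsub>T1\<^esub> Some \<beta> \<otimes>\<^bsub>T1\<^esub> m"
      "Some \<beta> = l' \<otimes>\<^bsub>T1\<^esub> Some \<alpha> \<otimes>\<^bsub>T1\<^esub> m'"
  shows "map_rank A F \<alpha> \<le>o alg_dim A F (\<beta> ` B)" "map_rank A F \<alpha> \<le>o alg_dim A F (\<alpha> ` B)"
    "map_rank A F \<beta> \<le>o alg_dim A F (\<beta> ` B)" "map_rank A F \<beta> \<le>o alg_dim A F (\<alpha> ` B)"
proof -
  have S: "Some \<phi> \<in> carrier T1" if "\<phi> \<in> T" for \<phi> using that T1_carrier by blast
  note C = S[OF T(1)] S[OF T(2)] S[OF T(3)] car
  have rank: "map_rank A F \<phi> \<le>o alg_dim A F (\<psi> ` B)"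
    if "\<phi> \<in> T" "\<psi> \<in> T" "\<delta> \<in> T" "l = Some \<delta>" "r \<in> carrier T1"
      "Some \<phi> = l \<otimes>\<^bsub>T1\<^esub> Some \<psi> \<otimes>\<^bsub>T1\<^esub> r" for \<phi> \<psi> \<delta> l r
    using map_rank_le_of_factor[OF that(3,2,5,1)] that(4,6) by simp
  show "map_rank A F \<alpha> \<le>o alg_dim A F (\<beta> ` B)"
    using rank[OF T(1,2,3) refl car(1) eq(1)] .
  \<comment> \<open>\<open>\<delta>1\<close>, \<open>\<delta>2\<close> and \<open>\<delta>3\<close>
    are the products \<gamma>l', l'\<gamma> and l'\<gamma>l', the left factors of the three
    substituted equations.\<close>
  obtain \<delta>1 where d1: "\<delta>1 \<in> T" "Some \<gamma> \<otimes>\<^bsub>T1\<^esub> l' = Some \<delta>1"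
    using Some_T_ideal(2)[OF T(3) car(2)] by blast
  obtain \<delta>2 where d2: "\<delta>2 \<in> T" "l' \<otimes>\<^bsub>T1\<^esub> Some \<gamma> = Some \<delta>2"
    using Some_T_ideal(1)[OF T(3) car(2)] by blast
  obtain \<delta>3 where d3: "\<delta>3 \<in> T" "l' \<otimes>\<^bsub>T1\<^esub> Some \<delta>1 = Some \<delta>3"
    using Some_T_ideal(1)[OF d1(1) car(2)] by blast
  have "Some \<alpha> = Some \<gamma> \<otimes>\<^bsub>T1\<^esub> (l' \<otimes>\<^bsub>T1\<^esub> Some \<alpha> \<otimes>\<^bsub>T1\<^esub> m') \<otimes>\<^bsub>T1\<^esub> m"
    using eq(1) unfolding eq(2)[symmetric] .
  also have "\<dots> = (Some \<gamma> \<otimes>\<^bsub>T1\<^esub> l') \<otimes>\<^bsub>T1\<^esub> Some \<alpha> \<otimes>\<^bsub>T1\<^esub> (m' \<otimes>\<^bsub>T1\<^esub> m)"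
    using C by (simp only: T1.m_assoc T1.m_closed)
  finally have e1: "Some \<alpha> = Some \<delta>1 \<otimes>\<^bsub>T1\<^esub> Some \<alpha> \<otimes>\<^bsub>T1\<^esub> (m' \<otimes>\<^bsub>T1\<^esub> m)"
    unfolding d1(2) .
  then show "map_rank A F \<alpha> \<le>o alg_dim A F (\<alpha> ` B)"
    by (rule rank[OF T(1) T(1) d1(1) refl T1.m_closed[OF car(3,1)]])
  have "Some \<beta> = l' \<otimes>\<^bsub>T1\<^esub> (Some \<gamma> \<otimes>\<^bsub>T1\<^esub> Some \<beta> \<otimes>\<^bsub>T1\<^esub> m) \<otimes>\<^bsub>T1\<^esub> m'"
    using eq(2) unfolding eq(1)[symmetric] .
  also have "\<dots> = (l' \<otimes>\<^bsub>T1\<^esub> Some \<gamma>) \<otimes>\<^bsub>T1\<^esub> Some \<beta> \<otimes>\<^bsub>T1\<^esub> (m \<otimes>\<^bsub>T1\<^esub> m')"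
    using C by (simp only: T1.m_assoc T1.m_closed)
  finally show "map_rank A F \<beta> \<le>o alg_dim A F (\<beta> ` B)"
    by (rule rank[OF T(2) T(2) d2(1) d2(2) T1.m_closed[OF car(1,3)]])
  \<comment> \<open>The left factor \<open>l'\<close> alone may be the identity, so \<alpha> is
    first replaced by its form \<open>e1\<close>, obtained by going once around the cycle.\<close>
  have "Some \<beta> = l' \<otimes>\<^bsub>T1\<^esub> (Some \<delta>1 \<otimes>\<^bsub>T1\<^esub> Some \<alpha> \<otimes>\<^bsub>T1\<^esub> (m' \<otimes>\<^bsub>T1\<^esub> m)) \<otimes>\<^bsub>T1\<^esub> m'"
    using eq(2) unfolding e1[symmetric] .
  also have "\<dots> = (l' \<otimes>\<^bsub>T1\<^esub> Some \<delta>1) \<otimes>\<^bsub>T1\<^esub> Some \<alpha> \<otimes>\<^bsub>T1\<^esub> (m' \<otimes>\<^bsub>T1\<^esub> m \<otimes>\<^bsub>T1\<^esub> m')"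
    using C S[OF d1(1)] by (simp only: T1.m_assoc T1.m_closed)
  finally show "map_rank A F \<beta> \<le>o alg_dim A F (\<alpha> ` B)"
    by (rule rank[OF T(2) T(1) d3(1) d3(2) T1.m_closed[OF T1.m_closed[OF car(3,1)] car(3)]])
qed

lemma alg_dim_image_le_map_rank:
  assumes "\<alpha> \<in> T"
  shows "alg_dim A F (\<alpha> ` B) \<le>o map_rank A F \<alpha>"
  unfolding map_rank_def
  using assms endos_intoD(1) subset_univ subalg is_subalgebra_univ
  by (intro alg_dim_mono is_subalgebra_image image_mono) auto

lemma green_J_T_iff:
  assumes T: "\<alpha> \<in> T" "\<beta> \<in> T"
  shows "green_J T (then_map A) \<alpha> \<beta> \<longleftrightarrow> map_ker A \<alpha> = map_ker A \<beta> \<or>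
    (map_rank A F \<alpha> =o alg_dim A F (\<alpha> ` B)
      \<and> alg_dim A F (\<alpha> ` B) =o alg_dim A F (\<beta> ` B)
      \<and> alg_dim A F (\<beta> ` B) =o map_rank A F \<beta>)" (is "?J \<longleftrightarrow> ?K \<or> ?D")
proof -
  let ?le = "\<lambda>\<phi> \<psi>. \<exists>x \<in> carrier T1. \<exists>y \<in> carrier T1.
    Some \<phi> = x \<otimes>\<^bsub>T1\<^esub> Some \<psi> \<otimes>\<^bsub>T1\<^esub> y"
  have J: "?J \<longleftrightarrow> ?le \<alpha> \<beta> \<and> ?le \<beta> \<alpha>"
    using green_J_iff[OF T1.monoid_axioms T] .
  have sub: "alg_dim A F (\<alpha> ` B) \<le>o map_rank A F \<alpha>" "alg_dim A F (\<beta> ` B) \<le>o map_rank A F \<beta>"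
    using alg_dim_image_le_map_rank T by auto
  \<comment> \<open>The bounds in \<open>sub\<close> run the other way, so these four inequalities
    force all four dimensions to coincide.\<close>
  have D: ?D
    if "map_rank A F \<alpha> \<le>o alg_dim A F (\<beta> ` B)" "map_rank A F \<alpha> \<le>o alg_dim A F (\<alpha> ` B)"
      "map_rank A F \<beta> \<le>o alg_dim A F (\<beta> ` B)" "map_rank A F \<beta> \<le>o alg_dim A F (\<alpha> ` B)"
    using that sub ordLeq_transitive[OF sub(1) that(1)] ordLeq_transitive[OF sub(2) that(4)]
    unfolding ordIso_iff_ordLeq by simp
  show ?thesis
  proof
    assume ?J
    then obtain l m l' m' where
      car: "l \<in> carrier T1" "m \<in> carrier T1" "l' \<in> carrier T1" "m' \<in> carrier T1"
      and eq: "Some \<alpha> = l \<otimes>\<^bsub>T1\<^esub> Some \<beta> \<otimes>\<^bsub>T1\<^esub> m"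
        "Some \<beta> = l' \<otimes>\<^bsub>T1\<^esub> Some \<alpha> \<otimes>\<^bsub>T1\<^esub> m'"
      unfolding J by blast
    \<comment> \<open>The last two cases overlap; one left factor in \<open>T\<close>
      suffices.\<close>
    consider "l = None" "l' = None" | \<gamma> where "\<gamma> \<in> T" "l = Some \<gamma>" | \<gamma> where "\<gamma> \<in> T" "l' = Some \<gamma>"
      using car(1,3) T1_carrier by auto
    then show "?K \<or> ?D"
    proof cases
      case 1
      then have ?K using eq car map_ker_right_factor by (intro subset_antisym) auto
      then show ?thesis ..
    next
      case (2 \<gamma>)
      have ?D
        by (rule D; rule map_rank_le_of_cycle[OF T 2(1) car(2,3,4) eq(1)[unfolded 2(2)] eq(2)])
      then show ?thesis ..
    next
      case (3 \<gamma>)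
      \<comment> \<open>The cycle read with \<alpha> and \<beta> exchanged yields the same four
        inequalities.\<close>
      have ?D
        by (rule D; rule map_rank_le_of_cycle[OF T(2,1) 3(1) car(4,1,2) eq(2)[unfolded 3(2)] eq(1)])
      then show ?thesis ..
    qed
  next
    assume "?K \<or> ?D"
    then show ?J
    proof
      assume K: ?K
      obtain \<mu> where "\<mu> \<in> T" "\<beta> = then_map A \<alpha> \<mu>"
        by (rule right_factor_of_ker_subset[OF T equalityD1[OF K]])
      moreover obtain \<nu> where "\<nu> \<in> T" "\<alpha> = then_map A \<beta> \<nu>"
        by (rule right_factor_of_ker_subset[OF T(2,1) equalityD2[OF K]])
      \<comment> \<open>For equal kernels the left factor is the adjoined identity in both
        directions.\<close>
      ultimately have "Some \<beta> = None \<otimes>\<^bsub>T1\<^esub> Some \<alpha> \<otimes>\<^bsub>T1\<^esub> Some \<mu>" "Some \<mu> \<in> carrier T1"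
        "Some \<alpha> = None \<otimes>\<^bsub>T1\<^esub> Some \<beta> \<otimes>\<^bsub>T1\<^esub> Some \<nu>" "Some \<nu> \<in> carrier T1"
        "None \<in> carrier T1"
        unfolding T1_carrier T1_mult by simp_all
      then show ?J unfolding J by blast
    next
      assume ?D
      then have d: "map_rank A F \<alpha> =o alg_dim A F (\<alpha> ` B)"
        "alg_dim A F (\<alpha> ` B) =o alg_dim A F (\<beta> ` B)"
        "alg_dim A F (\<beta> ` B) =o map_rank A F \<beta>"
        by simp_all
      have "map_rank A F \<alpha> \<le>o alg_dim A F (\<beta> ` B)"
        using ordIso_transitive[OF d(1,2)] ordIso_iff_ordLeq by blast
      moreover have "map_rank A F \<beta> \<le>o alg_dim A F (\<alpha> ` B)"
        using ordIso_transitive[OF d(2,3)] ordIso_iff_ordLeq by blast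
      moreover have "Some \<gamma> \<in> carrier T1" if "\<gamma> \<in> T" for \<gamma> using that T1_carrier by blast
      ultimately show ?J
        unfolding J factor_iff_map_rank_le[OF T, symmetric] factor_iff_map_rank_le[OF T(2,1), symmetric]
        by blast
    qed
  qed
qed

end

theorem proposition4p4:
  fixes A B :: "'a set" and F :: "'a ops"
  assumes "independence_algebra A F"
    and "is_subalgebra A F B"
    and "B \<noteq> {}"
    and "B \<noteq> A"
    and "ctwo \<le>o alg_dim A F B \<or> (gen F {} \<noteq> {} \<and> alg_dim A F B =o cone)"
    and "\<alpha> \<in> endos_into A F B"
    and "\<beta> \<in> endos_into A F B"
  shows "let T = endos_into A F B; T1 = adjoin_one T (then_map A) in
      ((\<exists>\<gamma> \<in> T. \<exists>\<mu> \<in> carrier T1. Some \<alpha> = Some \<gamma> \<otimes>\<^bsub>T1\<^esub> Some \<beta> \<otimes>\<^bsub>T1\<^esub> \<mu>)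
         \<longleftrightarrow> map_rank A F \<alpha> \<le>o alg_dim A F (\<beta> ` B))
    \<and> (green_J T (then_map A) \<alpha> \<beta>
         \<longleftrightarrow> map_ker A \<alpha> = map_ker A \<beta>
           \<or> (map_rank A F \<alpha> =o alg_dim A F (\<alpha> ` B)
              \<and> alg_dim A F (\<alpha> ` B) =o alg_dim A F (\<beta> ` B)
              \<and> alg_dim A F (\<beta> ` B) =o map_rank A F \<beta>))"
proof -
  interpret subalgebra_semigroup A F B
    using assms(1-3) unfolding independence_algebra_def is_algebra_def
    by unfold_locales auto
  show ?thesis
    unfolding Let_def
    by (intro conjI factor_iff_map_rank_le[OF assms(6,7)] green_J_T_iff[OF assms(6,7)])
qed

end
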